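(* Let $n\ge 1$ be an integer and let $H=\begin{bmatrix}A & B\\ B^* & C\end{bmatrix}\in\mathbb{M}_2(\mathbb{M}_n)$ be positive semidefinite. Then \[ 2\lVert\Phi(B)\rVert\le(n+1)\lVert\mathrm{tr}_2 H\rVert \] for any unitarily invariant norm $\lVert\cdot\rVert$.
   Context: $\mathbb{M}_n$ is the space of $n\times n$ complex matrices, and $\mathbb{M}_2(\mathbb{M}_n)$ is the set of $2\times 2$ block matrices with blocks in $\mathbb{M}_n$, regarded also as $2n\times 2n$ complex matrices. For $X\in\mathbb{M}_n$, $\Phi(X)=(\mathrm{tr}\,X)I+X$, where $I$ is the $n\times n$ identity matrix and $\mathrm{tr}$ is the usual trace. The second partial trace of $H$ is the $2\times2$ matrix $\mathrm{tr}_2 H=\begin{bmatrix}\mathrm{tr}\,A&\mathrm{tr}\,B\\ \mathrm{tr}\,B^*&\mathrm{tr}\,C\end{bmatrix}$. A norm $\lVert\cdot\rVert$ on $\mathbb{M}_N$ is unitarily invariant if $\lVert UXV\rVert=\lVert X\rVert$ for all $X\in\mathbb{M}_N$ and all unitary $U,V\in\mathbb{M}_N$. Since $\Phi(B)$ is $n\times n$ and $\mathrm{tr}_2 H$ is $2\times 2$, the norms are compared with the usual convention that the smaller matrix is enlarged by adding zero rows and columns: with $N=\max(n,2)$, $\lVert\cdot\rVert$ is a unitarily invariant norm on $\mathbb{M}_N$, and for $X\in\mathbb{M}_k$ with $k\le N$, $\lVert X\rVert$ means $\lVert X\oplus 0_{N-k}\rVert$. *)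

theory Defs
  imports "Jordan_Normal_Form.Schur_Decomposition"
begin

definition mat_trace :: "complex mat \<Rightarrow> complex" where
  "mat_trace A = (\<Sum>i<dim_row A. A $$ (i, i))"

definition positive_semidefinite :: "complex mat \<Rightarrow> bool" where
  "positive_semidefinite A \<longleftrightarrow>
     square_mat A \<and> mat_adjoint A = A \<and>
     (\<forall>v \<in> carrier_vec (dim_row A). Re ((A *\<^sub>v v) \<bullet>c v) \<ge> 0)"

definition unitary_mat :: "nat \<Rightarrow> complex mat \<Rightarrow> bool" where
  "unitary_mat N U \<longleftrightarrow>
     U \<in> carrier_mat N N \<and> mat_adjoint U * U = 1\<^sub>m N \<and> U * mat_adjoint U = 1\<^sub>m N"

text \<open>A norm on the vector space of complex \<open>N\<close> by \<open>N\<close> matrices; submultiplicativity is not required,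
  and the values of the function on matrices of other dimensions are irrelevant.\<close>

definition mat_norm_on :: "nat \<Rightarrow> (complex mat \<Rightarrow> real) \<Rightarrow> bool" where
  "mat_norm_on N f \<longleftrightarrow>
     (\<forall>X \<in> carrier_mat N N. f X \<ge> 0 \<and> (f X = 0 \<longleftrightarrow> X = 0\<^sub>m N N)) \<and>
     (\<forall>c. \<forall>X \<in> carrier_mat N N. f (c \<cdot>\<^sub>m X) = cmod c * f X) \<and>
     (\<forall>X \<in> carrier_mat N N. \<forall>Y \<in> carrier_mat N N. f (X + Y) \<le> f X + f Y)"

definition unitarily_invariant_norm :: "nat \<Rightarrow> (complex mat \<Rightarrow> real) \<Rightarrow> bool" where
  "unitarily_invariant_norm N f \<longleftrightarrow>
     mat_norm_on N f \<and>
     (\<forall>X \<in> carrier_mat N N. \<forall>U V. unitary_mat N U \<longrightarrow> unitary_mat N V \<longrightarrow> f (U * X * V) = f X)"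

text \<open>The matrix \<open>X \<oplus> 0\<close> of size \<open>N\<close> by \<open>N\<close>, for square \<open>X\<close> of size at most \<open>N\<close>.\<close>

definition zero_extend :: "nat \<Rightarrow> complex mat \<Rightarrow> complex mat" where
  "zero_extend N X =
     (let k = dim_row X in
      four_block_mat X (0\<^sub>m k (N - k)) (0\<^sub>m (N - k) k) (0\<^sub>m (N - k) (N - k)))"

definition Phi :: "complex mat \<Rightarrow> complex mat" where
  "Phi X = mat_trace X \<cdot>\<^sub>m 1\<^sub>m (dim_row X) + X"

text \<open>The second partial trace of a \<open>2n\<close> by \<open>2n\<close> matrix seen as a 2 by 2 block matrix with
  \<open>n\<close> by \<open>n\<close> blocks.\<close>

definition partial_trace2 :: "complex mat \<Rightarrow> complex mat" where
  "partial_trace2 H =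
     (let n = dim_row H div 2; (A, B, C, D) = split_block H n n in
      mat_of_rows_list 2 [[mat_trace A, mat_trace B], [mat_trace C, mat_trace D]])"

lemma partial_trace2_four_block_mat:
  assumes "A \<in> carrier_mat n n" "B \<in> carrier_mat n n" "C \<in> carrier_mat n n" "D \<in> carrier_mat n n"
  shows "partial_trace2 (four_block_mat A B C D) =
         mat_of_rows_list 2 [[mat_trace A, mat_trace B], [mat_trace C, mat_trace D]]"
proof -
  have "split_block (four_block_mat A B C D) n n = (A, B, C, D)"
    using assms by (auto simp: split_block_def Let_def intro!: eq_matI)
  then show ?thesis
    using assms by (simp add: partial_trace2_def)
qed

end

theory Submission
  imports Defs
begin

text \<open>
  Let \<open>g\<close> be the norm of the matrix unit with its entry in the top left corner. A unitarily
  invariant norm lies between the operator norm and the trace norm, both multiplied by \<open>g\<close>.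
  The inequality already holds when the left side is measured in the (larger) trace norm and the
  right side in the (smaller) operator norm, and this comparison carries it over to every
  unitarily invariant norm. In detail:

  \<^item> A rank one matrix \<open>p q\<^sup>*\<close> can be moved to a multiple of the corner matrix unit by unitaries, so
    it has norm \<open>\<bar>p\<bar> \<bar>q\<bar> g\<close> (lemma \<open>nrm_outer\<close>). Writing a matrix as a sum of rank one matrices
    therefore bounds its norm from above.

  \<^item> For unit vectors \<open>w\<close> and \<open>z\<close>, unitaries bring the number \<open>\<langle>w, X z\<rangle>\<close> into the corner of a matrix of
    the same norm as \<open>X\<close>, and averaging over sign changes removes all other entries. So
    \<open>\<bar>\<langle>w, X z\<rangle>\<bar> g\<close> bounds the norm of \<open>X\<close> from below (lemma \<open>form_le_nrm\<close>).

  Put \<open>b = tr B\<close> and \<open>\<tau> = tr H\<close>. Write \<open>H\<close> as a sum of matrices \<open>x x\<^sup>*\<close>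
  (lemma \<open>positive_semidefinite_gram\<close>) and split each vector \<open>x\<close> into its halves \<open>p\<close> and \<open>q\<close>. Then
  \<open>B\<close> is the sum of the \<open>p q\<^sup>*\<close>, and \<open>\<bar>p\<bar> \<bar>q\<bar> \<le> \<bar>x\<bar>\<^sup>2 / 2\<close> gives the bounds \<open>\<tau> g / 2\<close> for the norm of
  \<open>B\<close> and \<open>\<tau> / 2\<close> for \<open>\<bar>b\<bar>\<close>. As the identity is the sum of \<open>n\<close> matrix units, the norm of
  \<open>\<Phi>(B) = b I + B\<close> is at most \<open>(n \<bar>b\<bar> + \<tau> / 2) g\<close>.

  On the other side, the quadratic form of the partial trace takes the value \<open>\<tau> / 2 + \<bar>b\<bar>\<close> at the
  unit vector \<open>(\<zeta>, 1) / \<surd>2\<close>, where \<open>\<zeta>\<close> is the phase of \<open>b\<close>; hence its norm is at least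
  \<open>(\<tau> / 2 + \<bar>b\<bar>) g\<close>. Finally \<open>2 (n \<bar>b\<bar> + \<tau> / 2) \<le> (n + 1) (\<tau> / 2 + \<bar>b\<bar>)\<close> is the same as
  \<open>(n - 1) \<bar>b\<bar> \<le> (n - 1) \<tau> / 2\<close>.
\<close>

section \<open>Entries of adjoints and products\<close>

lemma mat_adjoint_carrier:
  "A \<in> carrier_mat n m \<Longrightarrow> mat_adjoint A \<in> carrier_mat m n"
  by (auto simp: mat_adjoint_def)

lemma mat_adjoint_index:
  assumes "A \<in> carrier_mat n m" "i < m" "j < n"
  shows "mat_adjoint A $$ (i, j) = cnj (A $$ (j, i))"
  using assms by (simp add: mat_adjoint_def mat_of_rows_index)

lemma mult_mat_index:
  assumes "A \<in> carrier_mat n m" "B \<in> carrier_mat m l" "i < n" "j < l"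
  shows "(A * B) $$ (i, j) = (\<Sum>k<m. A $$ (i, k) * B $$ (k, j))"
  using assms by (auto simp: scalar_prod_def atLeast0LessThan intro!: sum.cong)

lemma unitary_matI:
  assumes U: "U \<in> carrier_mat N N"
    and orth: "\<And>i j. i < N \<Longrightarrow> j < N \<Longrightarrow>
      (\<Sum>k<N. cnj (U $$ (k, i)) * U $$ (k, j)) = (if i = j then 1 else 0)"
  shows "unitary_mat N U"
proof -
  have a: "mat_adjoint U \<in> carrier_mat N N" using U by (rule mat_adjoint_carrier)
  have "mat_adjoint U * U = 1\<^sub>m N"
  proof (rule eq_matI)
    fix i j assume "i < dim_row (1\<^sub>m N :: complex mat)" "j < dim_col (1\<^sub>m N :: complex mat)"
    then have ij: "i < N" "j < N" by auto
    have "(mat_adjoint U * U) $$ (i, j) = (\<Sum>k<N. mat_adjoint U $$ (i, k) * U $$ (k, j))"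
      using a U ij by (rule mult_mat_index)
    also have "\<dots> = (\<Sum>k<N. cnj (U $$ (k, i)) * U $$ (k, j))"
      using U ij by (intro sum.cong) (auto simp: mat_adjoint_index)
    finally show "(mat_adjoint U * U) $$ (i, j) = 1\<^sub>m N $$ (i, j)"
      using orth ij by simp
  qed (use a U in auto)
  then show ?thesis
    using U a mat_mult_left_right_inverse[OF a U] by (auto simp: unitary_mat_def)
qed

lemma unitary_mat_adjoint:
  assumes "unitary_mat N U"
  shows "unitary_mat N (mat_adjoint U)"
proof -
  have U: "U \<in> carrier_mat N N" using assms by (simp add: unitary_mat_def)
  have a: "mat_adjoint U \<in> carrier_mat N N" using U by (rule mat_adjoint_carrier)
  have "mat_adjoint (mat_adjoint U) = U"
    using U a mat_adjoint_carrier[OF a]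
    by (intro eq_matI) (auto simp: mat_adjoint_index[OF a] mat_adjoint_index[OF U])
  then show ?thesis using assms a by (simp add: unitary_mat_def)
qed

lemma unitary_mat_one: "unitary_mat N (1\<^sub>m N)"
  by (rule unitary_matI) (auto simp: if_distrib[where f = "\<lambda>x. _ * x"] sum.delta cong: if_cong)

section \<open>Unitary matrices with a prescribed first column\<close>

text \<open>
  A scaled Householder reflection has this column. With \<open>z\<close> the phase of
  \<open>p 0\<close>, the vector \<open>cnj z * p\<close> has the nonnegative real number \<open>r\<close> as its entry 0; the reflection in the
  hyperplane orthogonal to \<open>w = cnj z * p + e\<^sub>0\<close> maps \<open>e\<^sub>0\<close> to \<open>- cnj z * p\<close>, and multiplication by
  \<open>- z\<close> corrects this to \<open>p\<close>. Removing the phase first keeps \<open>w\<close> away from zero: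
  \<open>\<bar>w\<bar>\<^sup>2 = 2 * (1 + r)\<close>.
\<close>

lemma unitary_with_first_column:
  fixes p :: "nat \<Rightarrow> complex"
  assumes N: "0 < N" and p: "(\<Sum>i<N. (cmod (p i))\<^sup>2) = 1"
  obtains U where "unitary_mat N U" "\<And>i. i < N \<Longrightarrow> U $$ (i, 0) = p i"
proof -
  define z where "z = (if p 0 = 0 then 1 else sgn (p 0))"
  define r where "r = cmod (p 0)"
  have "cmod z = 1" by (simp add: z_def norm_sgn)
  then have z: "z * cnj z = 1" "cnj z * z = 1"
    using complex_norm_square[of z] by (auto simp: mult.commute)
  have p0: "p 0 = z * of_real r" by (simp add: z_def r_def sgn_eq)
  have r: "1 + complex_of_real r \<noteq> 0"
    by (metis norm_ge_zero of_real_1 of_real_add of_real_eq_0_iff r_def add_nonneg_eq_0_iff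
        zero_le_one zero_neq_one)
  define w where "w i = cnj z * p i + (if i = 0 then 1 else 0)" for i
  define R where "R i j = (if i = j then 1 else 0) - w i * cnj (w j) / (1 + of_real r)" for i j
  define U where "U = mat N N (\<lambda>(i, j). - z * R i j)"
  have U: "U \<in> carrier_mat N N" by (simp add: U_def)
  have w0: "w 0 = 1 + of_real r" using z by (simp add: w_def p0 mult.assoc[symmetric])
  (* by this identity the factor 1 / (1 + r) in R is 2 divided by the squared length of w *)
  have sw: "(\<Sum>k<N. cnj (w k) * w k) = 2 * (1 + of_real r)"
  proof -
    have "cnj (w k) * w k = of_real ((cmod (p k))\<^sup>2) + (if k = 0 then 1 + 2 * of_real r else 0)" for k
    proof (cases "k = 0")
      case True
      have "complex_of_real ((cmod (p 0))\<^sup>2) = of_real (r\<^sup>2)" by (simp add: r_def)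
      then show ?thesis using True w0 by (simp add: algebra_simps power2_eq_square)
    next
      case False
      have "cnj (w k) * w k = (cnj z * z) * (p k * cnj (p k))"
        using False by (simp add: w_def algebra_simps)
      then show ?thesis using False z by (simp add: complex_norm_square del: of_real_power)
    qed
    then have "(\<Sum>k<N. cnj (w k) * w k) = of_real (\<Sum>k<N. (cmod (p k))\<^sup>2) + (1 + 2 * of_real r)"
      using N by (simp add: sum.distrib sum.delta)
    then show ?thesis by (simp add: p)
  qed
  have "unitary_mat N U"
  proof (rule unitary_matI[OF U])
    fix i j assume ij: "i < N" "j < N"
    have "(\<Sum>k<N. cnj (U $$ (k, i)) * U $$ (k, j)) = (\<Sum>k<N. R i k * R k j)"
    proof (rule sum.cong)
      fix k assume "k \<in> {..<N}"
      then have "cnj (U $$ (k, i)) * U $$ (k, j) = (cnj z * z) * (cnj (R k i) * R k j)"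
        using ij by (simp add: U_def algebra_simps)
      also have "cnj (R k i) = R i k" by (simp add: R_def mult.commute)
      finally show "cnj (U $$ (k, i)) * U $$ (k, j) = R i k * R k j" using z by simp
    qed simp
    also have "\<dots> = (\<Sum>k<N. (if k = i then R k j else 0)
        - (w i * cnj (w k) / (1 + of_real r)) * (if k = j then 1 else 0)
        + (w i * cnj (w j) / (1 + of_real r)\<^sup>2) * (cnj (w k) * w k))"
    proof (intro sum.cong refl)
      fix k
      have "R i k * R k j = (if i = k then 1 else 0) * R k j
          - (w i * cnj (w k) / (1 + of_real r)) * R k j"
        by (subst (1) R_def) (simp add: algebra_simps)
      also have "(w i * cnj (w k) / (1 + of_real r)) * R k j =
         (w i * cnj (w k) / (1 + of_real r)) * (if k = j then 1 else 0)
         - (w i * cnj (w j) / (1 + of_real r)\<^sup>2) * (cnj (w k) * w k)"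
        unfolding R_def by (simp only: right_diff_distrib) (simp add: power2_eq_square)
      finally show "R i k * R k j = (if k = i then R k j else 0)
        - (w i * cnj (w k) / (1 + of_real r)) * (if k = j then 1 else 0)
        + (w i * cnj (w j) / (1 + of_real r)\<^sup>2) * (cnj (w k) * w k)" by simp
    qed
    also have "\<dots> = R i j - w i * cnj (w j) / (1 + of_real r)
        + (w i * cnj (w j) / (1 + of_real r)\<^sup>2) * (2 * (1 + of_real r))"
    proof -
      have "(\<Sum>k<N. w i * cnj (w k) / (1 + of_real r) * (if k = j then 1 else 0))
          = w i * cnj (w j) / (1 + of_real r)"
        using ij by (simp add: if_distrib[where f = "\<lambda>x. _ * x"] cong: if_cong)
      then show ?thesis
        using ij by (simp only: sum.distrib sum_subtractf sum_distrib_left[symmetric] sw) simp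
    qed
    also have "\<dots> = (if i = j then 1 else 0)"
    proof -
      have "(a / c\<^sup>2) * (2 * c) = 2 * (a / c)" for a c :: complex
        by (cases "c = 0") (simp_all add: power2_eq_square)
      from this[of "w i * cnj (w j)" "1 + of_real r"] show ?thesis
        unfolding R_def by (simp only:) simp
    qed
    finally show "(\<Sum>k<N. cnj (U $$ (k, i)) * U $$ (k, j)) = (if i = j then 1 else 0)" .
  qed
  moreover have "U $$ (i, 0) = p i" if "i < N" for i
  proof -
    have "R i 0 = - cnj z * p i"
    proof (cases "i = 0")
      case True
      have "cnj z * p 0 = of_real r" using z by (simp add: p0 flip: mult.assoc)
      then show ?thesis using r True by (simp add: R_def w0)
    next
      case False
      then show ?thesis using r by (simp add: R_def w0) (simp add: w_def)
    qed
    then show ?thesis using that N z by (simp add: U_def mult.assoc[symmetric])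
  qed
  ultimately show ?thesis by (rule that)
qed

section \<open>Unitarily invariant norms and rank one matrices\<close>

definition outer :: "nat \<Rightarrow> (nat \<Rightarrow> complex) \<Rightarrow> (nat \<Rightarrow> complex) \<Rightarrow> complex mat" where
  "outer N p q = mat N N (\<lambda>(i, j). p i * cnj (q j))"

definition rank_one_norm :: "nat \<Rightarrow> (complex mat \<Rightarrow> real) \<Rightarrow> real" where
  "rank_one_norm N nrm = nrm (mat N N (\<lambda>(i, j). if i = 0 \<and> j = 0 then 1 else 0))"

lemma outer_carrier [simp]: "outer N p q \<in> carrier_mat N N"
  by (simp add: outer_def)

context
  fixes N :: nat and nrm :: "complex mat \<Rightarrow> real"
  assumes inv: "unitarily_invariant_norm N nrm"
begin

lemma nrm_nonneg: "X \<in> carrier_mat N N \<Longrightarrow> 0 \<le> nrm X"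
  and nrm_zero: "nrm (0\<^sub>m N N) = 0"
  and nrm_smult: "X \<in> carrier_mat N N \<Longrightarrow> nrm (c \<cdot>\<^sub>m X) = cmod c * nrm X"
  and nrm_add: "X \<in> carrier_mat N N \<Longrightarrow> Y \<in> carrier_mat N N \<Longrightarrow> nrm (X + Y) \<le> nrm X + nrm Y"
  and nrm_unitary: "X \<in> carrier_mat N N \<Longrightarrow> unitary_mat N U \<Longrightarrow> unitary_mat N V \<Longrightarrow>
    nrm (U * X * V) = nrm X"
  using inv by (auto simp: unitarily_invariant_norm_def mat_norm_on_def)

lemma nrm_unitary_left: "X \<in> carrier_mat N N \<Longrightarrow> unitary_mat N U \<Longrightarrow> nrm (U * X) = nrm X"
  using nrm_unitary[of X U "1\<^sub>m N"] unitary_mat_one by (auto simp: unitary_mat_def)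

lemma nrm_unitary_right: "X \<in> carrier_mat N N \<Longrightarrow> unitary_mat N V \<Longrightarrow> nrm (X * V) = nrm X"
  using nrm_unitary[of X "1\<^sub>m N" V] unitary_mat_one by (auto simp: unitary_mat_def)

lemma rank_one_norm_nonneg: "0 \<le> rank_one_norm N nrm"
  unfolding rank_one_norm_def by (rule nrm_nonneg) simp

lemma nrm_sum:
  assumes "finite I"
  shows "nrm (mat N N (\<lambda>(i, j). \<Sum>k\<in>I. f k i j)) \<le> (\<Sum>k\<in>I. nrm (mat N N (\<lambda>(i, j). f k i j)))"
  using assms
proof (induction I)
  case empty
  have "mat N N (\<lambda>(i, j). 0) = (0\<^sub>m N N :: complex mat)" by (intro eq_matI) auto
  then show ?case by (simp add: nrm_zero case_prod_unfold)
next
  case (insert a I)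
  have "mat N N (\<lambda>(i, j). \<Sum>k\<in>insert a I. f k i j)
      = mat N N (\<lambda>(i, j). f a i j) + mat N N (\<lambda>(i, j). \<Sum>k\<in>I. f k i j)"
    using insert.hyps by (intro eq_matI) auto
  then have "nrm (mat N N (\<lambda>(i, j). \<Sum>k\<in>insert a I. f k i j))
      \<le> nrm (mat N N (\<lambda>(i, j). f a i j)) + nrm (mat N N (\<lambda>(i, j). \<Sum>k\<in>I. f k i j))"
    by (metis (no_types, lifting) mat_carrier nrm_add)
  then show ?case using insert by simp
qed

text \<open>
  If \<open>p\<close> and \<open>q\<close> are the first columns of unitaries \<open>U\<close> and \<open>V\<close>, then \<open>outer N p q\<close> is
  \<open>U * E * mat_adjoint V\<close>, where \<open>E\<close> is the corner matrix unit.
\<close>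

lemma nrm_outer_unit:
  assumes N: "0 < N" and p: "(\<Sum>i<N. (cmod (p i))\<^sup>2) = 1" and q: "(\<Sum>i<N. (cmod (q i))\<^sup>2) = 1"
  shows "nrm (outer N p q) = rank_one_norm N nrm"
proof -
  obtain U where U: "unitary_mat N U" "\<And>i. i < N \<Longrightarrow> U $$ (i, 0) = p i"
    using unitary_with_first_column[OF N p] by blast
  obtain V where V: "unitary_mat N V" "\<And>i. i < N \<Longrightarrow> V $$ (i, 0) = q i"
    using unitary_with_first_column[OF N q] by blast
  let ?E = "mat N N (\<lambda>(i, j). if i = 0 \<and> j = 0 then 1 else 0) :: complex mat"
  have Uc: "U \<in> carrier_mat N N" and Vc: "V \<in> carrier_mat N N"
    using U V by (auto simp: unitary_mat_def)
  note Va = mat_adjoint_carrier[OF Vc]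
  have UE: "(U * ?E) $$ (i, j) = (if j = 0 then p i else 0)" if "i < N" "j < N" for i j
  proof -
    have "(U * ?E) $$ (i, j) = (\<Sum>k<N. U $$ (i, k) * ?E $$ (k, j))"
      by (rule mult_mat_index[OF Uc _ that]) simp
    also have "\<dots> = (\<Sum>k<N. if k = 0 then (if j = 0 then U $$ (i, 0) else 0) else 0)"
      using that by (intro sum.cong) auto
    finally show ?thesis using N U(2) that by simp
  qed
  have UEV: "(U * ?E * mat_adjoint V) $$ (i, j) = p i * cnj (q j)" if "i < N" "j < N" for i j
  proof -
    have "(U * ?E * mat_adjoint V) $$ (i, j) = (\<Sum>k<N. (U * ?E) $$ (i, k) * mat_adjoint V $$ (k, j))"
      by (rule mult_mat_index[OF _ Va that]) (use Uc in simp)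
    also have "\<dots> = (\<Sum>k<N. if k = 0 then p i * cnj (V $$ (j, 0)) else 0)"
      using that by (intro sum.cong) (auto simp: UE mat_adjoint_index[OF Vc])
    finally show ?thesis using N V(2) that by simp
  qed
  have "outer N p q = U * ?E * mat_adjoint V"
  proof (rule eq_matI)
    fix i j assume "i < dim_row (U * ?E * mat_adjoint V)" "j < dim_col (U * ?E * mat_adjoint V)"
    then have "i < N" "j < N" using Uc Va by auto
    then show "outer N p q $$ (i, j) = (U * ?E * mat_adjoint V) $$ (i, j)"
      using UEV by (simp add: outer_def)
  qed (use Uc Va in \<open>auto simp: outer_def\<close>)
  then show ?thesis
    using nrm_unitary[OF _ U(1) unitary_mat_adjoint[OF V(1)]] by (simp add: rank_one_norm_def)
qed

lemma nrm_outer: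
  assumes N: "0 < N"
  shows "nrm (outer N p q)
    = sqrt (\<Sum>i<N. (cmod (p i))\<^sup>2) * sqrt (\<Sum>i<N. (cmod (q i))\<^sup>2) * rank_one_norm N nrm"
proof -
  define S where "S p = sqrt (\<Sum>i<N. (cmod (p i))\<^sup>2)" for p :: "nat \<Rightarrow> complex"
  have S0: "p i = 0" if "S p = 0" "i < N" for p i
    using that by (auto simp: S_def sum_nonneg_eq_0_iff)
  have unit: "(\<Sum>i<N. (cmod (p i / of_real (S p)))\<^sup>2) = 1" if "S p \<noteq> 0" for p
  proof -
    have "(\<Sum>i<N. (cmod (p i / of_real (S p)))\<^sup>2) = (\<Sum>i<N. (cmod (p i))\<^sup>2) / (S p)\<^sup>2"
      by (simp add: norm_divide power_divide sum_divide_distrib)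
    also have "(S p)\<^sup>2 = (\<Sum>i<N. (cmod (p i))\<^sup>2)" by (simp add: S_def sum_nonneg)
    finally show ?thesis using that by (auto simp: S_def)
  qed
  show ?thesis
  proof (cases "S p = 0 \<or> S q = 0")
    case True
    then have "outer N p q = 0\<^sub>m N N"
      using S0 by (intro eq_matI) (auto simp: outer_def)
    then show ?thesis using True by (auto simp: nrm_zero S_def)
  next
    case False
    let ?u = "\<lambda>i. p i / of_real (S p)" and ?v = "\<lambda>i. q i / of_real (S q)"
    have "outer N p q = of_real (S p * S q) \<cdot>\<^sub>m outer N ?u ?v"
      using False by (intro eq_matI) (auto simp: outer_def)
    then have "nrm (outer N p q) = cmod (of_real (S p * S q)) * nrm (outer N ?u ?v)"
      by (simp only: nrm_smult[OF outer_carrier])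
    also have "cmod (of_real (S p * S q)) = S p * S q"
      by (subst norm_of_real) (simp add: S_def sum_nonneg)
    also have "nrm (outer N ?u ?v) = rank_one_norm N nrm"
      using False by (intro nrm_outer_unit[OF N] unit) auto
    finally show ?thesis by (simp add: S_def)
  qed
qed

text \<open>
  The unitary \<open>S = diag (1, -1, ..., -1)\<close> deletes entries by averaging: \<open>Y + S * Y\<close> is twice row 0
  of \<open>Y\<close>, and adding the product with \<open>S\<close> on the right leaves four times the corner entry. Each of the
  two steps at most doubles the norm.
\<close>

lemma corner_le_nrm:
  assumes N: "0 < N" and Y: "Y \<in> carrier_mat N N"
  shows "cmod (Y $$ (0, 0)) * rank_one_norm N nrm \<le> nrm Y"
proof -
  define S where "S = mat N N (\<lambda>(i, j). if i = j then (if i = 0 then 1 else - 1) else 0 :: complex)"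
  have Sc: "S \<in> carrier_mat N N" by (simp add: S_def)
  have S: "unitary_mat N S"
  proof (rule unitary_matI[OF Sc])
    fix i j assume ij: "i < N" "j < N"
    have "(\<Sum>k<N. cnj (S $$ (k, i)) * S $$ (k, j)) = (\<Sum>k<N. if k = i then (if i = j then 1 else 0) else 0)"
      using ij by (intro sum.cong) (auto simp: S_def)
    then show "(\<Sum>k<N. cnj (S $$ (k, i)) * S $$ (k, j)) = (if i = j then 1 else 0)"
      using ij by simp
  qed
  define Z where "Z = Y + S * Y"
  define W where "W = Z + Z * S"
  have Zc: "Z \<in> carrier_mat N N" using Y Sc by (simp add: Z_def)
  have Z: "Z $$ (i, j) = (if i = 0 then 2 * Y $$ (i, j) else 0)" if "i < N" "j < N" for i j
  proof -
    have "(S * Y) $$ (i, j) = (\<Sum>k<N. S $$ (i, k) * Y $$ (k, j))"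
      by (rule mult_mat_index[OF Sc Y that])
    also have "\<dots> = (\<Sum>k<N. if k = i then (if i = 0 then 1 else - 1) * Y $$ (i, j) else 0)"
      using that by (intro sum.cong) (auto simp: S_def)
    finally show ?thesis using that Y Sc by (simp add: Z_def)
  qed
  have W: "W $$ (i, j) = (if i = 0 \<and> j = 0 then 4 * Y $$ (0, 0) else 0)" if "i < N" "j < N" for i j
  proof -
    have "(Z * S) $$ (i, j) = (\<Sum>k<N. Z $$ (i, k) * S $$ (k, j))"
      by (rule mult_mat_index[OF Zc Sc that])
    also have "\<dots> = (\<Sum>k<N. if k = j then (if j = 0 then 1 else - 1) * Z $$ (i, j) else 0)"
      using that by (intro sum.cong) (auto simp: S_def)
    finally show ?thesis using that Zc Sc by (simp add: W_def Z)
  qed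
  let ?E = "mat N N (\<lambda>(i, j). if i = 0 \<and> j = 0 then 1 else 0) :: complex mat"
  have Wc: "W \<in> carrier_mat N N" using Zc Sc by (simp add: W_def)
  have "W = (4 * Y $$ (0, 0)) \<cdot>\<^sub>m ?E"
    using Wc by (intro eq_matI) (auto simp: W)
  then have "nrm W = cmod (4 * Y $$ (0, 0)) * nrm ?E"
    by (simp only: nrm_smult[OF mat_carrier])
  also have "\<dots> = 4 * (cmod (Y $$ (0, 0)) * rank_one_norm N nrm)"
    by (simp add: rank_one_norm_def norm_mult)
  finally have "4 * (cmod (Y $$ (0, 0)) * rank_one_norm N nrm) = nrm W" by simp
  also have "nrm W \<le> nrm Z + nrm (Z * S)"
    unfolding W_def using Zc Sc by (intro nrm_add) auto
  also have "nrm (Z * S) = nrm Z" by (rule nrm_unitary_right[OF Zc S])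
  also have "nrm Z \<le> nrm Y + nrm (S * Y)"
    unfolding Z_def using Y Sc by (intro nrm_add) auto
  also have "nrm (S * Y) = nrm Y" by (rule nrm_unitary_left[OF Y S])
  finally show ?thesis by simp
qed

text \<open>
  If \<open>w\<close> and \<open>z\<close> are the first columns of unitaries \<open>U\<close> and \<open>V\<close>, the form is the corner entry of
  \<open>mat_adjoint U * X * V\<close>.
\<close>

lemma form_le_nrm:
  assumes N: "0 < N" and X: "X \<in> carrier_mat N N"
    and w: "(\<Sum>i<N. (cmod (w i))\<^sup>2) = 1" and z: "(\<Sum>i<N. (cmod (z i))\<^sup>2) = 1"
  shows "cmod (\<Sum>i<N. \<Sum>j<N. cnj (w i) * X $$ (i, j) * z j) * rank_one_norm N nrm \<le> nrm X"
proof -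
  obtain U where U: "unitary_mat N U" "\<And>i. i < N \<Longrightarrow> U $$ (i, 0) = w i"
    using unitary_with_first_column[OF N w] by blast
  obtain V where V: "unitary_mat N V" "\<And>i. i < N \<Longrightarrow> V $$ (i, 0) = z i"
    using unitary_with_first_column[OF N z] by blast
  have Uc: "U \<in> carrier_mat N N" and Vc: "V \<in> carrier_mat N N"
    using U V by (auto simp: unitary_mat_def)
  note Ua = mat_adjoint_carrier[OF Uc]
  have XV: "X * V \<in> carrier_mat N N" using X Vc by simp
  let ?Y = "mat_adjoint U * (X * V)"
  have "?Y $$ (0, 0) = (\<Sum>i<N. mat_adjoint U $$ (0, i) * (X * V) $$ (i, 0))"
    by (rule mult_mat_index[OF Ua XV N N])
  also have "\<dots> = (\<Sum>i<N. \<Sum>j<N. cnj (w i) * X $$ (i, j) * z j)"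
  proof (rule sum.cong)
    fix i assume "i \<in> {..<N}"
    then have i: "i < N" by simp
    have "(X * V) $$ (i, 0) = (\<Sum>j<N. X $$ (i, j) * z j)"
      using mult_mat_index[OF X Vc i N] V(2) by simp
    then show "mat_adjoint U $$ (0, i) * (X * V) $$ (i, 0)
        = (\<Sum>j<N. cnj (w i) * X $$ (i, j) * z j)"
      using i N U(2) by (simp add: mat_adjoint_index[OF Uc] sum_distrib_left mult.assoc)
  qed simp
  finally have "cmod (\<Sum>i<N. \<Sum>j<N. cnj (w i) * X $$ (i, j) * z j) * rank_one_norm N nrm \<le> nrm ?Y"
    using corner_le_nrm[OF N, of ?Y] Ua XV by simp
  also have "nrm ?Y = nrm X"
    using nrm_unitary_left[OF XV unitary_mat_adjoint[OF U(1)]] nrm_unitary_right[OF X V(1)] by simp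
  finally show ?thesis .
qed

end

section \<open>Positive semidefinite matrices as sums of rank one matrices\<close>

text \<open>
  The dependence of the form on the last coordinate, used below to test positivity on vectors whose
  last coordinate is chosen in terms of the others.
\<close>

lemma hermitian_form_Suc:
  fixes h :: "nat \<Rightarrow> nat \<Rightarrow> complex"
  assumes herm: "\<And>i j. i < Suc m \<Longrightarrow> j < Suc m \<Longrightarrow> cnj (h j i) = h i j"
  shows "(\<Sum>i<Suc m. \<Sum>j<Suc m. cnj (v i) * h i j * v j)
    = (\<Sum>i<m. \<Sum>j<m. cnj (v i) * h i j * v j)
      + v m * cnj (\<Sum>j<m. h m j * v j) + cnj (v m) * (\<Sum>j<m. h m j * v j) + cnj (v m) * h m m * v m"
proof -
  have "(\<Sum>i<m. cnj (v i) * h i m * v m) = v m * cnj (\<Sum>j<m. h m j * v j)"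
    unfolding cnj_sum sum_distrib_left using herm by (intro sum.cong) (auto simp: mult_ac)
  moreover have "(\<Sum>j<m. cnj (v m) * h m j * v j) = cnj (v m) * (\<Sum>j<m. h m j * v j)"
    unfolding sum_distrib_left by (intro sum.cong) (auto simp: mult_ac)
  ultimately show ?thesis by (simp add: sum.distrib)
qed

text \<open>
  At the vector with entry 1 in place \<open>k\<close> and \<open>- t * h m k\<close> in place \<open>m\<close>, the form is
  \<open>h k k - 2 * t * (cmod (h m k))\<^sup>2\<close>, which is negative for large \<open>t\<close> unless \<open>h m k = 0\<close>.
\<close>

lemma psd_zero_pivot:
  fixes h :: "nat \<Rightarrow> nat \<Rightarrow> complex"
  assumes herm: "\<And>i j. i < Suc m \<Longrightarrow> j < Suc m \<Longrightarrow> cnj (h j i) = h i j"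
    and psd: "\<And>v. 0 \<le> Re (\<Sum>i<Suc m. \<Sum>j<Suc m. cnj (v i) * h i j * v j)"
    and 0: "h m m = 0" and k: "k < m"
  shows "h m k = 0"
proof (rule ccontr)
  assume nz: "h m k \<noteq> 0"
  define a where "a = Re (h k k)"
  define b where "b = (cmod (h m k))\<^sup>2"
  have b: "0 < b" using nz by (simp add: b_def)
  define t where "t = (\<bar>a\<bar> + 1) / b"
  define v where "v i = (if i = k then 1 else if i = m then - of_real t * h m k else 0)" for i
  have s: "(\<Sum>j<m. h m j * v j) = h m k"
  proof -
    have "(\<Sum>j<m. h m j * v j) = (\<Sum>j<m. if j = k then h m k else 0)"
      by (intro sum.cong) (auto simp: v_def)
    then show ?thesis using k by simp
  qed
  have q: "(\<Sum>i<m. \<Sum>j<m. cnj (v i) * h i j * v j) = h k k"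
  proof -
    have "(\<Sum>i<m. \<Sum>j<m. cnj (v i) * h i j * v j)
        = (\<Sum>i<m. \<Sum>j<m. if j = k then (if i = k then h k k else 0) else 0)"
      by (intro sum.cong) (auto simp: v_def)
    then show ?thesis using k by simp
  qed
  have vm: "v m = - of_real t * h m k" using k by (simp add: v_def)
  have bb: "h m k * cnj (h m k) = of_real b" unfolding b_def by (rule complex_norm_square[symmetric])
  have "(\<Sum>i<Suc m. \<Sum>j<Suc m. cnj (v i) * h i j * v j)
      = h k k + v m * cnj (h m k) + cnj (v m) * h m k + cnj (v m) * h m m * v m"
    using hermitian_form_Suc[of m h v] herm unfolding s q by blast
  also have "\<dots> = h k k - 2 * of_real t * (h m k * cnj (h m k))"
    by (simp add: vm 0 algebra_simps)
  also have "\<dots> = h k k - of_real (2 * t * b)" unfolding bb by simp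
  finally have "0 \<le> a - 2 * t * b" using psd[of v] by (simp add: a_def)
  moreover have "t * b = \<bar>a\<bar> + 1" using b by (simp add: t_def)
  ultimately show False by linarith
qed

text \<open>
  This is the Cholesky decomposition. Subtracting \<open>y y\<^sup>*\<close>, where \<open>y\<close> is the last column divided by the
  square root \<open>sqrt d\<close> of the last diagonal entry, clears the last row and column. The remaining
  Schur complement \<open>h'\<close> is again positive semidefinite, because its form at \<open>v\<close> is the form of \<open>h\<close>
  at the extension of \<open>v\<close> by the last coordinate that minimizes it. For \<open>d = 0\<close> the
  last row and column vanish, and with division by zero giving zero the same formulas apply.
\<close>

lemma psd_gram_decomposition:
  fixes h :: "nat \<Rightarrow> nat \<Rightarrow> complex"
  assumes "\<And>i j. i < m \<Longrightarrow> j < m \<Longrightarrow> cnj (h j i) = h i j"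
    and "\<And>v. 0 \<le> Re (\<Sum>i<m. \<Sum>j<m. cnj (v i) * h i j * v j)"
  shows "\<exists>x. \<forall>k<m. \<forall>l<m. h k l = (\<Sum>i<m. x i k * cnj (x i l))"
  using assms
proof (induction m arbitrary: h)
  case 0
  then show ?case by simp
next
  case (Suc m)
  note herm = Suc.prems(1) and psd = Suc.prems(2)
  define d where "d = Re (h m m)"
  have hd: "h m m = of_real d"
    using herm[of m m] by (simp add: d_def complex_eq_iff)
  define y where "y k = h k m / of_real (sqrt d)" for k
  have d0: "0 \<le> d"
  proof -
    have "(\<Sum>i<Suc m. \<Sum>j<Suc m. cnj (if i = m then 1 else 0) * h i j * (if j = m then 1 else 0)) = h m m"
      by simp
    then show ?thesis using psd[of "\<lambda>i. if i = m then 1 else 0"] by (simp add: d_def)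
  qed
  have yy: "y k * cnj (y l) = h k m * h m l / of_real d" if "k < Suc m" "l < Suc m" for k l
  proof -
    have "complex_of_real (sqrt d) * of_real (sqrt d) = of_real d"
      using d0 by (simp flip: of_real_mult)
    then show ?thesis using herm[of m l] that by (simp add: y_def)
  qed
  have row: "h k m * h m l / of_real d = h k l" if "k < Suc m" "l < Suc m" "k = m \<or> l = m" for k l
  proof (cases "d = 0")
    case True
    have z: "h m l = 0" if "l < Suc m" for l
      using psd_zero_pivot[OF herm psd, of l] hd True that by (cases "l = m") auto
    then have "h k m = 0" if "k < Suc m" for k
      using z[OF that] herm[of k m] that by simp
    then show ?thesis using z that by auto
  next
    case False
    then show ?thesis using that hd by auto
  qed
  define h' where "h' k l = h k l - h k m * h m l / of_real d" for k l
  have "\<exists>x. \<forall>k<m. \<forall>l<m. h' k l = (\<Sum>i<m. x i k * cnj (x i l))"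
  proof (rule Suc.IH)
    show "cnj (h' j i) = h' i j" if "i < m" "j < m" for i j
      using that herm by (simp add: h'_def mult.commute)
    show "0 \<le> Re (\<Sum>i<m. \<Sum>j<m. cnj (v i) * h' i j * v j)" for v
    proof -
      define s where "s = (\<Sum>j<m. h m j * v j)"
      (* completing the square: this last coordinate minimizes the form of h *)
      define u where "u i = (if i = m then - s / of_real d else v i)" for i
      have cs: "cnj s = (\<Sum>i<m. cnj (v i) * h i m)"
        unfolding s_def cnj_sum using herm by (intro sum.cong) auto
      have "(\<Sum>i<m. \<Sum>j<m. cnj (v i) * h' i j * v j)
          = (\<Sum>i<m. \<Sum>j<m. cnj (v i) * h i j * v j - (cnj (v i) * h i m) * (h m j * v j) / of_real d)"
        by (intro sum.cong) (auto simp: h'_def algebra_simps)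
      also have "\<dots> = (\<Sum>i<m. \<Sum>j<m. cnj (v i) * h i j * v j) - cnj s * s / of_real d"
      proof -
        have "cnj s * s = (\<Sum>i<m. \<Sum>j<m. (cnj (v i) * h i m) * (h m j * v j))"
          unfolding cs unfolding s_def by (rule sum_product)
        then show ?thesis by (simp add: sum_subtractf sum_divide_distrib)
      qed
      also have "\<dots> = (\<Sum>i<Suc m. \<Sum>j<Suc m. cnj (u i) * h i j * u j)"
      proof -
        have us: "(\<Sum>j<m. h m j * u j) = s" unfolding s_def by (intro sum.cong) (auto simp: u_def)
        have uq: "(\<Sum>i<m. \<Sum>j<m. cnj (u i) * h i j * u j) = (\<Sum>i<m. \<Sum>j<m. cnj (v i) * h i j * v j)"
          by (intro sum.cong) (auto simp: u_def)
        have um: "u m = - s / of_real d" by (simp add: u_def)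
        have "(\<Sum>i<Suc m. \<Sum>j<Suc m. cnj (u i) * h i j * u j)
            = (\<Sum>i<m. \<Sum>j<m. cnj (v i) * h i j * v j)
              + u m * cnj s + cnj (u m) * s + cnj (u m) * h m m * u m"
          using hermitian_form_Suc[of m h u] herm unfolding us uq by blast
        also have "\<dots> = (\<Sum>i<m. \<Sum>j<m. cnj (v i) * h i j * v j) - cnj s * s / of_real d"
          unfolding um hd by (cases "d = 0") (simp_all add: field_simps)
        finally show ?thesis by simp
      qed
      finally show ?thesis using psd[of u] by simp
    qed
  qed
  then obtain x where x: "\<And>k l. k < m \<Longrightarrow> l < m \<Longrightarrow> h' k l = (\<Sum>i<m. x i k * cnj (x i l))"
    by blast
  (* the vectors for h' live on the coordinates below m; their entry at m is set to zero *)
  define x' where "x' i k = (if i = m then y k else if k = m then 0 else x i k)" for i k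
  have "h k l = (\<Sum>i<Suc m. x' i k * cnj (x' i l))" if "k < Suc m" "l < Suc m" for k l
  proof -
    have "(\<Sum>i<m. x' i k * cnj (x' i l)) = h' k l"
    proof (cases "k = m \<or> l = m")
      case True
      then have "(\<Sum>i<m. x' i k * cnj (x' i l)) = 0" by (intro sum.neutral) (auto simp: x'_def)
      then show ?thesis using row[OF that True] by (simp add: h'_def)
    next
      case False
      then have "(\<Sum>i<m. x' i k * cnj (x' i l)) = (\<Sum>i<m. x i k * cnj (x i l))"
        by (intro sum.cong) (auto simp: x'_def)
      then show ?thesis using x[of k l] that False by simp
    qed
    then show ?thesis using yy[OF that] by (simp add: x'_def h'_def)
  qed
  then show ?case by blast
qed

lemma positive_semidefinite_gram:
  assumes psd: "positive_semidefinite H" and H: "H \<in> carrier_mat m m"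
  obtains x where "\<And>k l. k < m \<Longrightarrow> l < m \<Longrightarrow> H $$ (k, l) = (\<Sum>i<m. x i k * cnj (x i l))"
proof -
  have adj: "mat_adjoint H = H" using psd by (simp add: positive_semidefinite_def)
  have "\<exists>x. \<forall>k<m. \<forall>l<m. H $$ (k, l) = (\<Sum>i<m. x i k * cnj (x i l))"
  proof (rule psd_gram_decomposition)
    show "cnj (H $$ (j, i)) = H $$ (i, j)" if "i < m" "j < m" for i j
      using mat_adjoint_index[OF H that] adj by simp
    show "0 \<le> Re (\<Sum>i<m. \<Sum>j<m. cnj (v i) * H $$ (i, j) * v j)" for v
    proof -
      have "(H *\<^sub>v vec m v) \<bullet>c vec m v = (\<Sum>i<m. \<Sum>j<m. cnj (v i) * H $$ (i, j) * v j)"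
        using H by (auto simp: scalar_prod_def atLeast0LessThan sum_distrib_right sum_distrib_left
            algebra_simps intro!: sum.cong)
      moreover have "0 \<le> Re ((H *\<^sub>v vec m v) \<bullet>c vec m v)"
        using psd H by (auto simp: positive_semidefinite_def)
      ultimately show ?thesis by simp
    qed
  qed
  then show ?thesis using that by blast
qed

section \<open>The norm comparison\<close>

theorem corollary6p5:
  fixes n :: nat and A B C H :: "complex mat" and nrm :: "complex mat \<Rightarrow> real"
  assumes "n \<ge> 1"
    and "A \<in> carrier_mat n n" and "B \<in> carrier_mat n n" and "C \<in> carrier_mat n n"
    and "H = four_block_mat A B (mat_adjoint B) C"
    and "positive_semidefinite H"
    and "unitarily_invariant_norm (max n 2) nrm"
  shows "2 * nrm (zero_extend (max n 2) (Phi B))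
         \<le> (real n + 1) * nrm (zero_extend (max n 2) (partial_trace2 H))"
proof -
  define N where "N = max n 2"
  have N0: "0 < N" and N2: "2 \<le> N" and nN: "n \<le> N" by (auto simp: N_def)
  have inv: "unitarily_invariant_norm N nrm" using assms(7) by (simp add: N_def)
  define g where "g = rank_one_norm N nrm"
  have g: "0 \<le> g" unfolding g_def by (rule rank_one_norm_nonneg[OF inv])
  note A = assms(2) and B = assms(3) and C = assms(4)
  have Ba: "mat_adjoint B \<in> carrier_mat n n" using B by (rule mat_adjoint_carrier)
  have H: "H \<in> carrier_mat (n + n) (n + n)" unfolding assms(5) using A C by (rule four_block_carrier_mat)
  define b where "b = mat_trace B"
  have trA: "mat_trace A = (\<Sum>k<n. A $$ (k, k))" and trC: "mat_trace C = (\<Sum>k<n. C $$ (k, k))"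
    and trB: "b = (\<Sum>k<n. B $$ (k, k))"
    using A B C by (auto simp: mat_trace_def b_def)
  obtain x where x: "\<And>k l. k < n + n \<Longrightarrow> l < n + n \<Longrightarrow> H $$ (k, l) = (\<Sum>i<n + n. x i k * cnj (x i l))"
    using positive_semidefinite_gram[OF assms(6) H] by blast
  have xA: "A $$ (k, l) = (\<Sum>i<n + n. x i k * cnj (x i l))"
    and xB: "B $$ (k, l) = (\<Sum>i<n + n. x i k * cnj (x i (n + l)))"
    and xC: "C $$ (k, l) = (\<Sum>i<n + n. x i (n + k) * cnj (x i (n + l)))" if "k < n" "l < n" for k l
    using that A B C x[of k l] x[of k "n + l"] x[of "n + k" "n + l"]
    by (auto simp: assms(5))
  (* squared lengths of the two halves of the vectors x i *)
  define P where "P i = (\<Sum>k<n. (cmod (x i k))\<^sup>2)" for i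
  define Q where "Q i = (\<Sum>k<n. (cmod (x i (n + k)))\<^sup>2)" for i
  define \<tau> where "\<tau> = (\<Sum>i<n + n. P i + Q i)"
  have tr: "mat_trace A + mat_trace C = of_real \<tau>"
  proof -
    have "mat_trace A = (\<Sum>i<n + n. \<Sum>k<n. x i k * cnj (x i k))"
      unfolding trA using xA by (subst sum.swap) simp
    moreover have "mat_trace C = (\<Sum>i<n + n. \<Sum>k<n. x i (n + k) * cnj (x i (n + k)))"
      unfolding trC using xC by (subst sum.swap) simp
    ultimately show ?thesis
      by (simp add: \<tau>_def P_def Q_def sum.distrib complex_norm_square[symmetric] del: of_real_power)
  qed
  have b_le: "2 * cmod b \<le> \<tau>"
  proof -
    have "b = (\<Sum>i<n + n. \<Sum>k<n. x i k * cnj (x i (n + k)))"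
      unfolding trB using xB by (subst sum.swap) simp
    then have "cmod b \<le> (\<Sum>i<n + n. \<Sum>k<n. cmod (x i k * cnj (x i (n + k))))"
      by (auto intro!: sum_norm_le order.trans[OF norm_sum] sum_mono)
    also have "\<dots> \<le> (\<Sum>i<n + n. \<Sum>k<n. ((cmod (x i k))\<^sup>2 + (cmod (x i (n + k)))\<^sup>2) / 2)"
    proof (intro sum_mono)
      show "cmod (x i k * cnj (x i (n + k))) \<le> ((cmod (x i k))\<^sup>2 + (cmod (x i (n + k)))\<^sup>2) / 2" for i k
        using sum_squares_bound[of "cmod (x i k)" "cmod (x i (n + k))"] by (simp add: norm_mult)
    qed
    also have "\<dots> = \<tau> / 2"
      by (simp add: \<tau>_def P_def Q_def sum.distrib add_divide_distrib sum_divide_distrib)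
    finally show ?thesis by simp
  qed
  have upper: "nrm (zero_extend N (Phi B)) \<le> (real n * cmod b + \<tau> / 2) * g"
  proof -
    define e where "e k i = (if i = k then 1 else 0 :: complex)" for k i :: nat
    define p where "p i k = (if k < n then x i k else 0)" for i k
    define q where "q i k = (if k < n then x i (n + k) else 0)" for i k
    have sum_cut: "(\<Sum>k<N. (cmod (if k < n then f k else 0))\<^sup>2) = (\<Sum>k<n. (cmod (f k))\<^sup>2)"
      for f :: "nat \<Rightarrow> complex"
    proof -
      have "(\<Sum>k<N. (cmod (if k < n then f k else 0))\<^sup>2) = (\<Sum>k<N. if k < n then (cmod (f k))\<^sup>2 else 0)"
        by (intro sum.cong) auto
      also have "\<dots> = (\<Sum>k\<in>{..<N} \<inter> {k. k < n}. (cmod (f k))\<^sup>2)"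
        by (simp add: sum.If_cases)
      also have "{..<N} \<inter> {k. k < n} = {..<n}" using nN by auto
      finally show ?thesis .
    qed
    have pP: "(\<Sum>k<N. (cmod (p i k))\<^sup>2) = P i" and qQ: "(\<Sum>k<N. (cmod (q i k))\<^sup>2) = Q i" for i
      unfolding p_def q_def P_def Q_def by (rule sum_cut)+
    (* E is the zero-extended identity and F the zero-extended B *)
    define E where "E = mat N N (\<lambda>(i, j). \<Sum>k<n. e k i * cnj (e k j))"
    define F where "F = mat N N (\<lambda>(k, l). \<Sum>i<n + n. p i k * cnj (q i l))"
    have Ec: "E \<in> carrier_mat N N" and Fc: "F \<in> carrier_mat N N" by (auto simp: E_def F_def)
    have split: "zero_extend N (Phi B) = b \<cdot>\<^sub>m E + F"
    proof (rule eq_matI)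
      fix i j assume "i < dim_row (b \<cdot>\<^sub>m E + F)" "j < dim_col (b \<cdot>\<^sub>m E + F)"
      then have ij: "i < N" "j < N" by (auto simp: E_def F_def)
      have Eij: "E $$ (i, j) = (if i = j \<and> i < n then 1 else 0)"
      proof -
        have "E $$ (i, j) = (\<Sum>k<n. e k i * cnj (e k j))"
          using ij by (simp add: E_def)
        also have "\<dots> = (\<Sum>k<n. if k = i then (if i = j then 1 else 0) else 0)"
          by (intro sum.cong) (auto simp: e_def)
        finally show ?thesis by simp
      qed
      have Fij: "F $$ (i, j) = (if i < n \<and> j < n then B $$ (i, j) else 0)"
        using ij xB[of i j] by (simp add: F_def p_def q_def)
      show "zero_extend N (Phi B) $$ (i, j) = (b \<cdot>\<^sub>m E + F) $$ (i, j)"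
        using ij B nN Ec Fc by (auto simp: zero_extend_def Phi_def Let_def Eij Fij b_def)
    qed (use B nN in \<open>auto simp: zero_extend_def Phi_def Let_def E_def F_def\<close>)
    have "nrm E \<le> (\<Sum>k<n. nrm (outer N (e k) (e k)))"
      unfolding E_def outer_def by (rule nrm_sum[OF inv]) simp
    also have "\<dots> = (\<Sum>k<n. g)"
    proof (rule sum.cong)
      fix k assume "k \<in> {..<n}"
      then have "(\<Sum>i<N. (cmod (e k i))\<^sup>2) = 1"
        using nN by (simp add: e_def if_distrib[where f = cmod] if_distrib[where f = "\<lambda>x. x\<^sup>2"] cong: if_cong)
      then show "nrm (outer N (e k) (e k)) = g"
        using nrm_outer_unit[OF inv N0] by (simp add: g_def)
    qed simp
    finally have nE: "nrm E \<le> real n * g" by simp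
    have "nrm F \<le> (\<Sum>i<n + n. nrm (outer N (p i) (q i)))"
      unfolding F_def outer_def by (rule nrm_sum[OF inv]) simp
    also have "\<dots> \<le> (\<Sum>i<n + n. (P i + Q i) / 2 * g)"
    proof (rule sum_mono)
      fix i
      have "0 \<le> P i" "0 \<le> Q i" by (auto simp: P_def Q_def sum_nonneg)
      then have "sqrt (P i) * sqrt (Q i) \<le> (P i + Q i) / 2"
        using arith_geo_mean_sqrt[of "P i" "Q i"] by (simp add: real_sqrt_mult)
      then show "nrm (outer N (p i) (q i)) \<le> (P i + Q i) / 2 * g"
        unfolding nrm_outer[OF inv N0] pP qQ g_def[symmetric] using g by (rule mult_right_mono)
    qed
    also have "\<dots> = \<tau> / 2 * g"
      by (simp add: \<tau>_def sum_distrib_right[symmetric] sum_divide_distrib[symmetric])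
    finally have nF: "nrm F \<le> \<tau> / 2 * g" .
    have "nrm (zero_extend N (Phi B)) \<le> cmod b * nrm E + nrm F"
      unfolding split using nrm_add[OF inv, of "b \<cdot>\<^sub>m E" F] nrm_smult[OF inv Ec] Ec Fc by simp
    also have "\<dots> \<le> cmod b * (real n * g) + \<tau> / 2 * g"
      using nE nF by (intro add_mono mult_left_mono) auto
    finally show ?thesis by (simp add: algebra_simps)
  qed
  have lower: "(\<tau> / 2 + cmod b) * g \<le> nrm (zero_extend N (partial_trace2 H))"
  proof -
    define T where "T = zero_extend N (partial_trace2 H)"
    have trBa: "mat_trace (mat_adjoint B) = cnj b"
    proof -
      have "mat_trace (mat_adjoint B) = (\<Sum>k<n. mat_adjoint B $$ (k, k))"
        using Ba by (simp add: mat_trace_def)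
      also have "\<dots> = (\<Sum>k<n. cnj (B $$ (k, k)))"
        by (intro sum.cong) (auto simp: mat_adjoint_index[OF B])
      finally show ?thesis by (simp add: trB)
    qed
    define M where "M = mat_of_rows_list 2 [[mat_trace A, b], [cnj b, mat_trace C]]"
    have pt: "partial_trace2 H = M"
      unfolding assms(5) partial_trace2_four_block_mat[OF A B Ba C] trBa M_def b_def ..
    have M: "M \<in> carrier_mat 2 2" and M_ij: "M $$ (0, 0) = mat_trace A" "M $$ (0, Suc 0) = b"
      "M $$ (Suc 0, 0) = cnj b" "M $$ (Suc 0, Suc 0) = mat_trace C"
      by (auto simp: M_def mat_of_rows_list_def numeral_2_eq_2)
    have T: "T \<in> carrier_mat N N"
      unfolding T_def zero_extend_def pt Let_def using M N2
      by (intro carrier_matI) auto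
    define z where "z = (if b = 0 then 1 else sgn b)"
    have z1: "cmod z = 1" by (simp add: z_def norm_sgn)
    then have z: "cnj z * z = 1"
      using complex_norm_square[of z] by (simp add: mult.commute)
    have bz: "b = z * of_real (cmod b)" by (simp add: z_def sgn_eq)
    (* the unit vector (z, 1) / sqrt 2, in which the phase z makes both off-diagonal terms
       of the form equal to |b| *)
    define w where "w i = (if i = 0 then z / of_real (sqrt 2) else if i = Suc 0 then 1 / of_real (sqrt 2) else 0)"
      for i :: nat
    have two: "{0, Suc 0} \<subseteq> {..<N}" using N2 by auto
    have restrict: "(\<Sum>i<N. f i) = f 0 + f (Suc 0)"
      if "\<And>i. i \<notin> {0, Suc 0} \<Longrightarrow> f i = 0" for f :: "nat \<Rightarrow> 'a :: comm_monoid_add"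
      using sum.mono_neutral_right[OF _ two, of f] that by auto
    have wu: "(\<Sum>i<N. (cmod (w i))\<^sup>2) = 1"
      by (subst restrict) (auto simp: w_def norm_divide z1 power_divide)
    have Tij: "T $$ (i, j) = M $$ (i, j)" if "i < 2" "j < 2" for i j
      using that M N2 unfolding T_def zero_extend_def pt Let_def by simp
    have s2: "complex_of_real (sqrt 2) * of_real (sqrt 2) = 2"
      by (simp flip: of_real_mult)
    have "(\<Sum>i<N. \<Sum>j<N. cnj (w i) * T $$ (i, j) * w j)
        = (\<Sum>i<N. cnj (w i) * T $$ (i, 0) * w 0 + cnj (w i) * T $$ (i, Suc 0) * w (Suc 0))"
      by (intro sum.cong restrict) (auto simp: w_def)
    also have "\<dots> = (cnj (w 0) * T $$ (0, 0) * w 0 + cnj (w 0) * T $$ (0, Suc 0) * w (Suc 0))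
        + (cnj (w (Suc 0)) * T $$ (Suc 0, 0) * w 0 + cnj (w (Suc 0)) * T $$ (Suc 0, Suc 0) * w (Suc 0))"
      by (rule restrict) (auto simp: w_def)
    also have "\<dots> = ((cnj z * z) * mat_trace A + cnj z * b + cnj b * z + mat_trace C) / 2"
      unfolding s2[symmetric] by (simp add: w_def Tij M_ij field_simps)
    also have "\<dots> = of_real (\<tau> / 2 + cmod b)"
    proof -
      have "cnj z * b = of_real (cmod b)"
        using z by (subst bz) (simp flip: mult.assoc)
      moreover from arg_cong[OF this, of cnj] have "cnj b * z = of_real (cmod b)"
        by (simp add: mult.commute)
      ultimately have "(cnj z * z) * mat_trace A + cnj z * b + cnj b * z + mat_trace C
          = (mat_trace A + mat_trace C) + 2 * of_real (cmod b)"
        using z by simp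
      then show ?thesis unfolding tr by (simp add: add_divide_distrib)
    qed
    finally have form: "(\<Sum>i<N. \<Sum>j<N. cnj (w i) * T $$ (i, j) * w j) = of_real (\<tau> / 2 + cmod b)" .
    have "cmod (of_real (\<tau> / 2 + cmod b)) * g \<le> nrm T"
      using form_le_nrm[OF inv N0 T wu wu] unfolding form g_def .
    moreover have "0 \<le> \<tau> / 2 + cmod b" using b_le norm_ge_zero[of b] by linarith
    ultimately show ?thesis unfolding T_def by (simp only: norm_of_real abs_of_nonneg)
  qed
  have "2 * (real n * cmod b + \<tau> / 2) \<le> (real n + 1) * (\<tau> / 2 + cmod b)"
  proof -
    have "(real n - 1) * cmod b \<le> (real n - 1) * (\<tau> / 2)"
      using assms(1) b_le by (intro mult_left_mono) auto
    then show ?thesis by (simp add: field_simps)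
  qed
  from mult_right_mono[OF this g]
  have "2 * ((real n * cmod b + \<tau> / 2) * g) \<le> (real n + 1) * ((\<tau> / 2 + cmod b) * g)"
    by (simp only: mult.assoc)
  moreover have "\<dots> \<le> (real n + 1) * nrm (zero_extend N (partial_trace2 H))"
    using lower by (intro mult_left_mono) auto
  ultimately show ?thesis using upper unfolding N_def by linarith
qed

end
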